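(* Let $D$ be a positive integer and let $\Gamma\subseteq\mathbb{R}^D$ be orthosymmetric, compact and convex. Then for every $\epsilon>0$, $$n_{\mathrm{gof}}\Big(\Gamma,\frac{\epsilon}{\sqrt2}\Big)^2\ge \frac{1}{64\log(2D)}\cdot\frac{n_{\mathrm{est}}(\Gamma,\epsilon)}{\epsilon^2}.$$
   Context: A set $\Gamma\subseteq\mathbb{R}^D$ is orthosymmetric if for every $\boldsymbol\theta=(\theta_1,\dots,\theta_D)\in\Gamma$ and every sign vector $(\epsilon_1,\dots,\epsilon_D)\in\{-1,1\}^D$, $(\epsilon_1\theta_1,\dots,\epsilon_D\theta_D)\in\Gamma$. Model: $\{\mathcal N(\boldsymbol\theta,I_D):\boldsymbol\theta\in\Gamma\}$. $n_{\mathrm{est}}(\Gamma,\epsilon)$ is the smallest $n$ such that from $n$ i.i.d. samples of $\mathcal N(\boldsymbol\theta,I_D)$ some estimator $\hat{\boldsymbol\theta}$ achieves $\sup_{\boldsymbol\theta\in\Gamma}\mathbb E\|\hat{\boldsymbol\theta}-\boldsymbol\theta\|_2^2\le\epsilon^2$. $n_{\mathrm{gof}}(\Gamma,\epsilon)$ is the smallest $n$ such that from $n$ i.i.d. samples of $\mathcal N(\boldsymbol\theta,I_D)$, $\boldsymbol\theta\in\Gamma$, some test $\psi\in\{0,1\}$ of $H_0:\boldsymbol\theta=\mathbf 0$ vs $H_1:\boldsymbol\theta\in\Gamma,\|\boldsymbol\theta\|_2\ge\epsilon$ has $\mathbb P_{\mathbf 0}(\psi=1)\le1/4$ and $\sup_{H_1}\mathbb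 P_{\boldsymbol\theta}(\psi=0)\le 1/4$. *)

theory Defs
  imports "HOL-Probability.Probability"
begin

definition orthosymmetric :: "(real ^ 'd) set \<Rightarrow> bool" where
  "orthosymmetric \<Gamma> \<longleftrightarrow>
     (\<forall>\<theta>\<in>\<Gamma>. \<forall>s :: 'd \<Rightarrow> real. (\<forall>i. s i \<in> {-1, 1}) \<longrightarrow> (\<chi> i. s i * \<theta> $ i) \<in> \<Gamma>)"

definition gauss :: "real ^ 'd \<Rightarrow> (real ^ 'd) measure" where
  "gauss \<theta> = density lborel (\<lambda>x. ennreal (\<Prod>i\<in>UNIV. normal_density (\<theta> $ i) 1 (x $ i)))"

definition samples :: "nat \<Rightarrow> real ^ 'd \<Rightarrow> (nat \<Rightarrow> real ^ 'd) measure" where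
  "samples n \<theta> = PiM {..<n} (\<lambda>_. gauss \<theta>)"

definition sample_space :: "nat \<Rightarrow> (nat \<Rightarrow> real ^ 'd) measure" where
  "sample_space n = PiM {..<n} (\<lambda>_. borel)"

definition est_ok :: "(real ^ 'd) set \<Rightarrow> real \<Rightarrow> nat \<Rightarrow> bool" where
  "est_ok \<Gamma> \<epsilon> n \<longleftrightarrow>
     (\<exists>f :: (nat \<Rightarrow> real ^ 'd) \<Rightarrow> real ^ 'd. f \<in> borel_measurable (sample_space n) \<and>
        (\<forall>\<theta>\<in>\<Gamma>. (\<integral>\<^sup>+ x. ennreal ((norm (f x - \<theta>))\<^sup>2) \<partial>samples n \<theta>) \<le> ennreal (\<epsilon>\<^sup>2)))"

definition n_est :: "(real ^ 'd) set \<Rightarrow> real \<Rightarrow> nat" where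
  "n_est \<Gamma> \<epsilon> = (LEAST n. est_ok \<Gamma> \<epsilon> n)"

definition gof_ok :: "(real ^ 'd) set \<Rightarrow> real \<Rightarrow> nat \<Rightarrow> bool" where
  "gof_ok \<Gamma> \<epsilon> n \<longleftrightarrow>
     (\<exists>\<psi> :: (nat \<Rightarrow> real ^ 'd) \<Rightarrow> bool. \<psi> \<in> measurable (sample_space n) (count_space UNIV) \<and>
        measure (samples n 0) {x \<in> space (samples n 0). \<psi> x} \<le> 1/4 \<and>
        (\<forall>\<theta>\<in>\<Gamma>. norm \<theta> \<ge> \<epsilon> \<longrightarrow>
            measure (samples n \<theta>) {x \<in> space (samples n \<theta>). \<not> \<psi> x} \<le> 1/4))"

definition n_gof :: "(real ^ 'd) set \<Rightarrow> real \<Rightarrow> nat" where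
  "n_gof \<Gamma> \<epsilon> = (LEAST n. gof_ok \<Gamma> \<epsilon> n)"

end

theory Submission
  imports Defs
begin

text \<open>
  Let \<open>\<delta> = \<epsilon> / \<surd>2\<close> and suppose that \<open>n\<close> samples suffice for testing at radius \<open>\<delta>\<close>. The uniform
  mixture over all sign changes of a point \<open>\<theta>\<close> with \<open>\<parallel>\<theta>\<parallel> \<ge> \<delta>\<close> has a likelihood ratio with second
  moment \<open>\<Prod>i. cosh (n \<theta>\<^sub>i\<^sup>2)\<close> under the null, so by Cauchy-Schwarz a test can only exist if
  \<open>n\<^sup>2 \<parallel>\<theta>\<parallel>\<^sub>4\<^sup>4 \<ge> 1\<close>. An orthosymmetric convex set contains every vector that is dominated
  coordinatewise by one of its points, so truncating \<open>\<theta>\<close> at a level \<open>T\<close> with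
  \<open>n T \<delta> < 1\<close> must bring its norm below \<open>\<delta>\<close>; that is,
  \<open>\<Sum>i. min \<theta>\<^sub>i\<^sup>2 T\<^sup>2 < \<epsilon>\<^sup>2 / 2\<close> on all of \<open>\<Gamma>\<close>. Soft thresholding the sample
  mean of \<open>m \<approx> 64 log (2D) n\<^sup>2 \<epsilon>\<^sup>2\<close> observations at level \<open>T / 2\<close> with
  \<open>T\<^sup>2 = 64 log (2D) / m\<close> has risk at most this sum plus \<open>1 / m \<le> \<epsilon>\<^sup>2 / 2\<close>.
\<close>

section \<open>Elementary inequalities\<close>

lemma cosh_le_exp_power2_half: "cosh x \<le> exp (x\<^sup>2 / 2)" for x :: real
proof -
  have "- \<bar>x\<bar> + ln ((1 + exp (2 * \<bar>x\<bar>)) / 2) \<le> x\<^sup>2 / 2"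
    using Hoeffdings_lemma_aux[of "2 * \<bar>x\<bar>" "1/2"] by (simp add: field_simps)
  then have "exp (- \<bar>x\<bar> + ln ((1 + exp (2 * \<bar>x\<bar>)) / 2)) \<le> exp (x\<^sup>2 / 2)"
    by simp
  also have "exp (- \<bar>x\<bar> + ln ((1 + exp (2 * \<bar>x\<bar>)) / 2)) = exp (- \<bar>x\<bar>) * ((1 + exp (2 * \<bar>x\<bar>)) / 2)"
    by (subst exp_add) (simp add: add_pos_pos)
  also have "\<dots> = cosh \<bar>x\<bar>"
    by (simp add: cosh_field_def field_simps flip: exp_add)
  finally show ?thesis
    by simp
qed

lemma sum_exp_signs_eq_prod_cosh:
  fixes c :: "'a \<Rightarrow> real"
  assumes "finite I"
  shows "(\<Sum>t\<in>I \<rightarrow>\<^sub>E {-1, 1}. exp (\<Sum>i\<in>I. t i * c i)) = 2 ^ card I * (\<Prod>i\<in>I. cosh (c i))"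
proof -
  have "(\<Sum>t\<in>I \<rightarrow>\<^sub>E {-1, 1}. exp (\<Sum>i\<in>I. t i * c i))
      = (\<Sum>t\<in>I \<rightarrow>\<^sub>E {-1, 1}. \<Prod>i\<in>I. exp (t i * c i))"
    using assms by (simp add: exp_sum)
  also have "\<dots> = (\<Prod>i\<in>I. \<Sum>s\<in>{-1, 1}. exp (s * c i))"
    using assms by (subst prod_sum_PiE) auto
  also have "\<dots> = (\<Prod>i\<in>I. 2 * cosh (c i))"
    by (simp add: cosh_field_def add_divide_distrib add.commute)
  finally show ?thesis
    by (simp add: prod.distrib)
qed

lemma exp_1_half_less: "exp (1/2 :: real) < 9/4"
proof (rule power_less_imp_less_base)
  have "(exp (1/2 :: real))\<^sup>2 = exp 1"
    by (simp flip: exp_double)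
  then show "(exp (1/2 :: real))\<^sup>2 < (9/4)\<^sup>2"
    using exp_le by (simp add: power2_eq_square)
qed simp

lemma half_less_ln_double: "1/2 < ln (2 * x)" if "1 \<le> x" for x :: real
proof -
  have "ln 2 \<le> ln (2 * x)"
    using that by simp
  then show ?thesis
    using ln2_ge_two_thirds by linarith
qed

lemma exp_minus_4_ln_double_le:
  fixes D :: real
  assumes "1 \<le> D"
  shows "8 * sqrt 2 * D * exp (- (4 * ln (2 * D))) \<le> 1"
proof -
  have "exp (- (4 * ln (2 * D))) = 1 / (2 * D) ^ 4"
    using assms by (simp add: exp_minus exp_of_nat_mult[of 4, simplified] inverse_eq_divide)
  moreover have "8 * sqrt 2 * D \<le> (2 * D) ^ 4"
  proof -
    have "8 * sqrt 2 * D \<le> 16 * D ^ 1"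
      using assms sqrt2_less_2 by simp
    also have "\<dots> \<le> 16 * D ^ 4"
      using assms by (intro mult_left_mono power_increasing) auto
    finally show ?thesis
      by (simp add: power_mult_distrib)
  qed
  ultimately show ?thesis
    using assms by (simp add: divide_le_eq_1_pos)
qed

lemma norm_power2_vec: "(norm x)\<^sup>2 = (\<Sum>i\<in>UNIV. (x $ i)\<^sup>2)" for x :: "real ^ 'd"
  by (simp add: norm_vec_def L2_set_def sum_nonneg)

section \<open>Integrals, densities and product measures\<close>

lemma mixture_power_le_second_moment:
  assumes [measurable]: "\<And>s. s \<in> S \<Longrightarrow> L s \<in> borel_measurable M" "E \<in> sets M"
    and power: "\<And>s. s \<in> S \<Longrightarrow> \<beta> \<le> emeasure (density M (L s)) E"
  shows "(of_nat (card S) * \<beta>)\<^sup>2 \<le> (\<Sum>s\<in>S. \<Sum>t\<in>S. \<integral>\<^sup>+x. L s x * L t x \<partial>M) * emeasure M E"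
proof -
  have "of_nat (card S) * \<beta> \<le> (\<Sum>s\<in>S. emeasure (density M (L s)) E)"
    using power by (simp add: sum_bounded_below)
  also have "\<dots> = (\<Sum>s\<in>S. \<integral>\<^sup>+x. L s x * indicator E x \<partial>M)"
    by (intro sum.cong refl emeasure_density) measurable
  also have "\<dots> = (\<integral>\<^sup>+x. (\<Sum>s\<in>S. L s x) * indicator E x \<partial>M)"
    by (subst nn_integral_sum[symmetric]) (auto simp: sum_distrib_right)
  finally have "(of_nat (card S) * \<beta>)\<^sup>2 \<le> (\<integral>\<^sup>+x. (\<Sum>s\<in>S. L s x) * indicator E x \<partial>M)\<^sup>2"
    by (intro power_mono) auto
  also have "\<dots> \<le> (\<integral>\<^sup>+x. (\<Sum>s\<in>S. L s x)\<^sup>2 \<partial>M) * (\<integral>\<^sup>+x. (indicator E x)\<^sup>2 \<partial>M)"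
    by (intro Cauchy_Schwarz_nn_integral) measurable
  also have "(\<integral>\<^sup>+x. (indicator E x)\<^sup>2 \<partial>M) = emeasure M E"
    by (simp add: power2_eq_square flip: indicator_inter_arith)
  also have "(\<integral>\<^sup>+x. (\<Sum>s\<in>S. L s x)\<^sup>2 \<partial>M) = (\<integral>\<^sup>+x. (\<Sum>s\<in>S. \<Sum>t\<in>S. L s x * L t x) \<partial>M)"
    by (simp add: power2_eq_square sum_product)
  also have "\<dots> = (\<Sum>s\<in>S. \<Sum>t\<in>S. \<integral>\<^sup>+x. L s x * L t x \<partial>M)"
    by (simp add: nn_integral_sum)
  finally show ?thesis .
qed

lemma nn_integral_lborel_prod_cart:
  fixes f :: "'d::finite \<Rightarrow> real \<Rightarrow> ennreal"
  assumes [measurable]: "\<And>i. f i \<in> borel_measurable borel"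
  shows "(\<integral>\<^sup>+x. (\<Prod>i\<in>UNIV. f i (x $ i)) \<partial>(lborel :: (real ^ 'd) measure))
      = (\<Prod>i\<in>UNIV. \<integral>\<^sup>+y. f i y \<partial>lborel)"
proof -
  have inj: "inj (\<lambda>i :: 'd. axis i (1 :: real))"
    by (auto simp: inj_def axis_eq_axis)
  have Basis: "(Basis :: (real ^ 'd) set) = range (\<lambda>i. axis i 1)"
    by (auto simp: Basis_vec_def)
  define g where "g b = f (inv (\<lambda>i. axis i 1) b)" for b :: "real ^ 'd"
  have "(\<integral>\<^sup>+x. (\<Prod>b\<in>Basis. g b (x \<bullet> b)) \<partial>(lborel :: (real ^ 'd) measure))
      = (\<Prod>b\<in>Basis. \<integral>\<^sup>+y. g b y \<partial>lborel)"
    by (rule nn_integral_lborel_prod) (auto simp: g_def)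
  then show ?thesis
    unfolding Basis by (simp add: prod.reindex[OF inj] g_def inv_f_f[OF inj] inner_axis)
qed

lemma indep_vars_PiM_component:
  assumes "I \<noteq> {}" and M: "\<And>i. i \<in> I \<Longrightarrow> prob_space (M i)"
  shows "prob_space.indep_vars (PiM I M) M (\<lambda>i x. x i) I"
proof -
  interpret prob_space "PiM I M"
    by (rule prob_space_PiM[OF M])
  have "distr (PiM I M) (PiM I M) (\<lambda>x. \<lambda>i\<in>I. x i) = distr (PiM I M) (PiM I M) (\<lambda>x. x)"
    by (intro distr_cong) (auto simp: space_PiM)
  also have "\<dots> = (\<Pi>\<^sub>M i\<in>I. distr (PiM I M) (M i) (\<lambda>x. x i))"
    by (subst distr_id2) (auto intro!: PiM_cong simp: distr_PiM_component M)
  finally show ?thesis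
    by (subst indep_vars_iff_distr_eq_PiM'[OF assms(1)]) auto
qed

lemma PiM_density:
  assumes "finite I" and [measurable]: "\<And>i. i \<in> I \<Longrightarrow> f i \<in> borel_measurable (M i)"
    and "product_sigma_finite M" and "product_sigma_finite (\<lambda>i. density (M i) (f i))"
  shows "PiM I (\<lambda>i. density (M i) (f i)) = density (PiM I M) (\<lambda>x. \<Prod>i\<in>I. f i (x i))"
proof -
  interpret M: product_sigma_finite M by fact
  interpret N: product_sigma_finite "\<lambda>i. density (M i) (f i)" by fact
  show ?thesis
  proof (rule N.PiM_eqI[symmetric])
    fix A assume "\<And>i. i \<in> I \<Longrightarrow> A i \<in> sets (density (M i) (f i))"
    then have A [measurable]: "A i \<in> sets (M i)" if "i \<in> I" for i
      using that by simp
    have indicator: "indicator (Pi\<^sub>E I A) x = (\<Prod>i\<in>I. indicator (A i) (x i) :: ennreal)"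
      if "x \<in> space (PiM I M)" for x
      using that \<open>finite I\<close>
      by (auto simp: indicator_def PiE_iff space_PiM prod_eq_1_iff intro!: prod_zero[symmetric])
    have "emeasure (density (PiM I M) (\<lambda>x. \<Prod>i\<in>I. f i (x i))) (Pi\<^sub>E I A)
       = (\<integral>\<^sup>+x. (\<Prod>i\<in>I. f i (x i)) * indicator (Pi\<^sub>E I A) x \<partial>PiM I M)"
      using \<open>finite I\<close> A by (intro emeasure_density sets_PiM_I_finite) auto
    also have "\<dots> = (\<integral>\<^sup>+x. (\<Prod>i\<in>I. f i (x i) * indicator (A i) (x i)) \<partial>PiM I M)"
      by (intro nn_integral_cong) (simp add: indicator prod.distrib)
    also have "\<dots> = (\<Prod>i\<in>I. \<integral>\<^sup>+x. f i x * indicator (A i) x \<partial>M i)"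
      using \<open>finite I\<close> by (intro M.product_nn_integral_prod) auto
    also have "\<dots> = (\<Prod>i\<in>I. emeasure (density (M i) (f i)) (A i))"
      by (intro prod.cong refl) (simp add: emeasure_density)
    finally show "emeasure (density (PiM I M) (\<lambda>x. \<Prod>i\<in>I. f i (x i))) (Pi\<^sub>E I A)
        = (\<Prod>i\<in>I. emeasure (density (M i) (f i)) (A i))" .
  qed (use \<open>finite I\<close> in \<open>auto intro!: sets_PiM_cong\<close>)
qed

lemma nn_integral_normal_density: "0 < \<sigma> \<Longrightarrow> (\<integral>\<^sup>+y. ennreal (normal_density \<mu> \<sigma> y) \<partial>lborel) = 1"
  by (subst nn_integral_eq_integral) auto

lemma nn_integral_normal_density_variance:
  assumes "0 < \<sigma>"
  shows "(\<integral>\<^sup>+y. ennreal (normal_density \<mu> \<sigma> y * (y - \<mu>)\<^sup>2) \<partial>lborel) = ennreal (\<sigma>\<^sup>2)"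
  using normal_moment_even[OF assms, of \<mu> 1]
  by (subst nn_integral_eq_integral) (auto simp: has_bochner_integral_iff)

text \<open>One half of the exponent pays for the restriction to a tail, the other half is the density
  of a normal law of twice the variance.\<close>

lemma normal_density_sqrt2_scale:
  "normal_density \<mu> \<sigma> y
     = sqrt 2 * exp (- ((y - \<mu>)\<^sup>2 / (4 * \<sigma>\<^sup>2))) * normal_density \<mu> (sqrt 2 * \<sigma>) y"
proof -
  have "exp (- ((y - \<mu>)\<^sup>2 / (4 * \<sigma>\<^sup>2))) * exp (- ((y - \<mu>)\<^sup>2 / (4 * \<sigma>\<^sup>2)))
      = exp (- ((y - \<mu>)\<^sup>2 / (2 * \<sigma>\<^sup>2)))"
    by (simp flip: exp_add)
  then show ?thesis
    by (cases "\<sigma> = 0") (simp_all add: normal_density_def power_mult_distrib real_sqrt_mult field_simps)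
qed

lemma nn_integral_normal_density_tail_le:
  assumes "0 < \<sigma>" "0 \<le> \<tau>"
  shows "(\<integral>\<^sup>+y. ennreal (normal_density \<mu> \<sigma> y * ((y - \<mu>)\<^sup>2 * indicator {y. \<tau> < \<bar>y - \<mu>\<bar>} y)) \<partial>lborel)
     \<le> ennreal (2 * sqrt 2 * \<sigma>\<^sup>2 * exp (- (\<tau>\<^sup>2 / (4 * \<sigma>\<^sup>2))))"
proof -
  let ?C = "sqrt 2 * exp (- (\<tau>\<^sup>2 / (4 * \<sigma>\<^sup>2)))"
  have "normal_density \<mu> \<sigma> y * ((y - \<mu>)\<^sup>2 * indicator {y. \<tau> < \<bar>y - \<mu>\<bar>} y)
      \<le> ?C * (normal_density \<mu> (sqrt 2 * \<sigma>) y * (y - \<mu>)\<^sup>2)" for y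
  proof (cases "\<tau> < \<bar>y - \<mu>\<bar>")
    case True
    then have "\<tau>\<^sup>2 \<le> (y - \<mu>)\<^sup>2"
      using assms(2) by (simp flip: abs_le_square_iff)
    then have "exp (- ((y - \<mu>)\<^sup>2 / (4 * \<sigma>\<^sup>2))) \<le> exp (- (\<tau>\<^sup>2 / (4 * \<sigma>\<^sup>2)))"
      by (simp add: divide_right_mono)
    then have "normal_density \<mu> \<sigma> y \<le> ?C * normal_density \<mu> (sqrt 2 * \<sigma>) y"
      unfolding normal_density_sqrt2_scale[of \<mu> \<sigma>] by (intro mult_right_mono mult_left_mono) auto
    then have "normal_density \<mu> \<sigma> y * (y - \<mu>)\<^sup>2 \<le> ?C * normal_density \<mu> (sqrt 2 * \<sigma>) y * (y - \<mu>)\<^sup>2"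
      by (rule mult_right_mono) simp
    with True show ?thesis
      by (simp add: mult.assoc)
  qed simp
  then have "(\<integral>\<^sup>+y. ennreal (normal_density \<mu> \<sigma> y * ((y - \<mu>)\<^sup>2 * indicator {y. \<tau> < \<bar>y - \<mu>\<bar>} y)) \<partial>lborel)
      \<le> (\<integral>\<^sup>+y. ennreal ?C * ennreal (normal_density \<mu> (sqrt 2 * \<sigma>) y * (y - \<mu>)\<^sup>2) \<partial>lborel)"
    by (intro nn_integral_mono) (simp add: ennreal_leI flip: ennreal_mult)
  also have "\<dots> = ennreal ?C * ennreal ((sqrt 2 * \<sigma>)\<^sup>2)"
    using assms(1) by (simp add: nn_integral_cmult nn_integral_normal_density_variance)
  also have "\<dots> = ennreal (2 * sqrt 2 * \<sigma>\<^sup>2 * exp (- (\<tau>\<^sup>2 / (4 * \<sigma>\<^sup>2))))"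
    by (simp add: power_mult_distrib mult_ac flip: ennreal_mult)
  finally show ?thesis .
qed

section \<open>The Gaussian location model\<close>

lemma sets_gauss [measurable_cong, simp]: "sets (gauss \<theta>) = sets borel"
  by (simp add: gauss_def)

lemma space_gauss [simp]: "space (gauss \<theta>) = UNIV"
  by (simp add: gauss_def)

lemma nn_integral_gauss_prod:
  fixes \<theta> :: "real ^ 'd"
  assumes [measurable]: "\<And>i. f i \<in> borel_measurable borel"
  shows "(\<integral>\<^sup>+x. (\<Prod>i\<in>UNIV. f i (x $ i)) \<partial>gauss \<theta>)
      = (\<Prod>i\<in>UNIV. \<integral>\<^sup>+y. ennreal (normal_density (\<theta> $ i) 1 y) * f i y \<partial>lborel)"
proof -
  have "(\<integral>\<^sup>+x. (\<Prod>i\<in>UNIV. f i (x $ i)) \<partial>gauss \<theta>)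
      = (\<integral>\<^sup>+x. (\<Prod>i\<in>UNIV. ennreal (normal_density (\<theta> $ i) 1 (x $ i)) * f i (x $ i)) \<partial>lborel)"
    unfolding gauss_def by (subst nn_integral_density) (auto simp: prod.distrib prod_ennreal)
  also have "\<dots> = (\<Prod>i\<in>UNIV. \<integral>\<^sup>+y. ennreal (normal_density (\<theta> $ i) 1 y) * f i y \<partial>lborel)"
    by (rule nn_integral_lborel_prod_cart) measurable
  finally show ?thesis .
qed

lemma prob_space_gauss: "prob_space (gauss \<theta>)"
proof
  show "emeasure (gauss \<theta>) (space (gauss \<theta>)) = 1"
    using nn_integral_gauss_prod[of "\<lambda>_ _. 1" \<theta>] by (simp add: nn_integral_normal_density)
qed

lemma distributed_gauss_component:
  fixes \<theta> :: "real ^ 'd"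
  shows "distributed (gauss \<theta>) lborel (\<lambda>x. x $ k) (normal_density (\<theta> $ k) 1)"
  unfolding distributed_def
proof (intro conjI measure_eqI)
  fix A assume "A \<in> sets (distr (gauss \<theta>) lborel (\<lambda>x. x $ k))"
  then have [measurable]: "A \<in> sets borel" by simp
  let ?f = "\<lambda>i y. if i = k then indicator A y else 1 :: ennreal"
  have "emeasure (distr (gauss \<theta>) lborel (\<lambda>x. x $ k)) A
      = (\<integral>\<^sup>+y. indicator A y \<partial>distr (gauss \<theta>) lborel (\<lambda>x. x $ k))"
    by simp
  also have "\<dots> = (\<integral>\<^sup>+x. indicator A (x $ k) \<partial>gauss \<theta>)"
    by (rule nn_integral_distr) auto
  also have "\<dots> = (\<integral>\<^sup>+x. (\<Prod>i\<in>UNIV. ?f i (x $ i)) \<partial>gauss \<theta>)"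
    by simp
  also have "\<dots> = (\<Prod>i\<in>UNIV. \<integral>\<^sup>+y. ennreal (normal_density (\<theta> $ i) 1 y) * ?f i y \<partial>lborel)"
    by (rule nn_integral_gauss_prod) simp
  also have "\<dots> = (\<Prod>i\<in>UNIV. if i = k
      then \<integral>\<^sup>+y. ennreal (normal_density (\<theta> $ k) 1 y) * indicator A y \<partial>lborel else 1)"
    by (intro prod.cong refl) (simp add: nn_integral_normal_density)
  also have "\<dots> = emeasure (density lborel (normal_density (\<theta> $ k) 1)) A"
    by (simp add: emeasure_density)
  finally show "emeasure (distr (gauss \<theta>) lborel (\<lambda>x. x $ k)) A
      = emeasure (density lborel (normal_density (\<theta> $ k) 1)) A" .
qed auto

lemma gauss_eq_density:
  "gauss \<theta> = density (gauss 0) (\<lambda>x. ennreal (exp (\<theta> \<bullet> x - (norm \<theta>)\<^sup>2 / 2)))"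
proof -
  have shift: "normal_density \<mu> 1 y = normal_density 0 1 y * exp (\<mu> * y - \<mu>\<^sup>2 / 2)" for \<mu> y :: real
  proof -
    have "- ((y - \<mu>)\<^sup>2) / 2 = - (y\<^sup>2) / 2 + (\<mu> * y - \<mu>\<^sup>2 / 2)"
      by (simp add: power2_eq_square field_simps)
    then show ?thesis
      by (simp only: normal_density_def flip: exp_add) (simp flip: exp_add)
  qed
  have "(\<Prod>i\<in>UNIV. normal_density (\<theta> $ i) 1 (x $ i))
      = (\<Prod>i\<in>UNIV. normal_density 0 1 (x $ i)) * exp (\<theta> \<bullet> x - (norm \<theta>)\<^sup>2 / 2)" for x
    by (subst shift)
      (simp add: prod.distrib sum_subtractf inner_vec_def norm_power2_vec sum_divide_distrib
        flip: exp_sum)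
  then show ?thesis
    unfolding gauss_def by (subst density_density_eq) (auto simp: ennreal_mult prod_nonneg)
qed

lemma prob_space_samples: "prob_space (samples n \<theta>)"
  unfolding samples_def by (intro prob_space_PiM prob_space_gauss)

lemma sets_samples [measurable_cong, simp]: "sets (samples n \<theta>) = sets (sample_space n)"
  unfolding samples_def sample_space_def by (intro sets_PiM_cong) auto

lemma space_samples: "space (samples n \<theta>) = space (sample_space n)"
  by (rule sets_eq_imp_space_eq) simp

lemma measurable_sum_samples [measurable]:
  "(\<lambda>x. \<Sum>j<n. x j) \<in> borel_measurable (sample_space n :: (nat \<Rightarrow> real ^ 'd) measure)"
  unfolding sample_space_def by (intro borel_measurable_sum measurable_component_singleton) auto

definition likelihood_ratio :: "nat \<Rightarrow> real ^ 'd \<Rightarrow> (nat \<Rightarrow> real ^ 'd) \<Rightarrow> real" where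
  "likelihood_ratio n \<theta> x = exp (\<theta> \<bullet> (\<Sum>j<n. x j) - real n * (norm \<theta>)\<^sup>2 / 2)"

lemma measurable_likelihood_ratio [measurable]:
  "likelihood_ratio n \<theta> \<in> borel_measurable (sample_space n)"
  unfolding likelihood_ratio_def by measurable

lemma samples_eq_density: "samples n \<theta> = density (samples n 0) (likelihood_ratio n \<theta>)"
proof -
  let ?L = "\<lambda>x. ennreal (exp (\<theta> \<bullet> x - (norm \<theta>)\<^sup>2 / 2))"
  have sigma_finite: "product_sigma_finite (\<lambda>_ :: nat. gauss \<eta>)" for \<eta> :: "real ^ 'd"
    by (intro product_sigma_finite.intro prob_space_imp_sigma_finite prob_space_gauss)
  have "samples n \<theta> = (\<Pi>\<^sub>M j\<in>{..<n}. density (gauss 0) ?L)"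
    unfolding samples_def by (subst gauss_eq_density) (rule refl)
  also have "\<dots> = density (samples n 0) (\<lambda>x. \<Prod>j<n. ?L (x j))"
    unfolding samples_def
    by (rule PiM_density) (simp_all add: sigma_finite flip: gauss_eq_density)
  also have "(\<lambda>x. \<Prod>j<n. ?L (x j)) = (\<lambda>x. ennreal (likelihood_ratio n \<theta> x))"
    by (simp add: likelihood_ratio_def prod_ennreal sum_subtractf inner_sum_right flip: exp_sum)
  finally show ?thesis .
qed

lemma nn_integral_likelihood_ratio: "(\<integral>\<^sup>+x. ennreal (likelihood_ratio n \<theta> x) \<partial>samples n 0) = 1"
proof -
  have "(\<integral>\<^sup>+x. ennreal (likelihood_ratio n \<theta> x) \<partial>samples n 0) = (\<integral>\<^sup>+x. 1 \<partial>samples n \<theta>)"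
    by (subst (2) samples_eq_density, subst nn_integral_density) auto
  then show ?thesis
    by (simp add: prob_space.emeasure_space_1[OF prob_space_samples])
qed

lemma nn_integral_likelihood_ratio_mult:
  "(\<integral>\<^sup>+x. ennreal (likelihood_ratio n a x) * ennreal (likelihood_ratio n b x) \<partial>samples n 0)
     = ennreal (exp (real n * (a \<bullet> b)))"
proof -
  have "(norm (a + b))\<^sup>2 = (norm a)\<^sup>2 + 2 * (a \<bullet> b) + (norm b)\<^sup>2"
    by (simp add: power2_norm_eq_inner inner_add inner_commute del: dot_square_norm)
  then have "likelihood_ratio n a x * likelihood_ratio n b x
      = exp (real n * (a \<bullet> b)) * likelihood_ratio n (a + b) x" for x
    unfolding likelihood_ratio_def exp_add[symmetric]
    by (simp add: inner_add_left field_simps)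
  then have "(\<integral>\<^sup>+x. ennreal (likelihood_ratio n a x) * ennreal (likelihood_ratio n b x) \<partial>samples n 0)
      = (\<integral>\<^sup>+x. ennreal (exp (real n * (a \<bullet> b))) * ennreal (likelihood_ratio n (a + b) x) \<partial>samples n 0)"
    by (simp add: likelihood_ratio_def flip: ennreal_mult)
  then show ?thesis
    by (simp add: nn_integral_cmult nn_integral_likelihood_ratio)
qed

definition sample_mean :: "nat \<Rightarrow> (nat \<Rightarrow> real ^ 'd) \<Rightarrow> real ^ 'd" where
  "sample_mean n x = (1 / real n) *\<^sub>R (\<Sum>j<n. x j)"

lemma measurable_sample_mean [measurable]:
  "sample_mean n \<in> borel_measurable (sample_space n :: (nat \<Rightarrow> real ^ 'd) measure)"
  unfolding sample_mean_def by measurable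

lemma distributed_samples_component:
  fixes \<theta> :: "real ^ 'd"
  assumes "j < n"
  shows "distributed (samples n \<theta>) lborel (\<lambda>x. x j $ i) (normal_density (\<theta> $ i) 1)"
proof -
  have [measurable]: "(\<lambda>x. x j) \<in> measurable (samples n \<theta>) (gauss \<theta>)"
    unfolding samples_def using assms by simp
  have "distr (samples n \<theta>) lborel (\<lambda>x. x j $ i)
      = distr (distr (samples n \<theta>) (gauss \<theta>) (\<lambda>x. x j)) lborel (\<lambda>x. x $ i)"
    by (subst distr_distr) (auto simp: comp_def)
  also have "distr (samples n \<theta>) (gauss \<theta>) (\<lambda>x. x j) = gauss \<theta>"
    unfolding samples_def using assms by (intro distr_PiM_component prob_space_gauss) auto
  finally have "distr (samples n \<theta>) lborel (\<lambda>x. x j $ i) = density lborel (normal_density (\<theta> $ i) 1)"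
    by (simp add: distributed_distr_eq_density[OF distributed_gauss_component])
  moreover have "(\<lambda>x. x j $ i) \<in> borel_measurable (samples n \<theta>)"
    by (rule measurable_compose[of "\<lambda>x. x j" _ "gauss \<theta>"]) simp_all
  ultimately show ?thesis
    by (simp add: distributed_def)
qed

lemma distributed_sample_mean_component:
  fixes \<theta> :: "real ^ 'd"
  assumes "0 < n"
  shows "distributed (samples n \<theta>) lborel (\<lambda>x. sample_mean n x $ i)
     (normal_density (\<theta> $ i) (1 / sqrt (real n)))"
proof -
  interpret prob_space "samples n \<theta>"
    by (rule prob_space_samples)
  have "indep_vars (\<lambda>_. gauss \<theta>) (\<lambda>j x. x j) {..<n}"
    unfolding samples_def using assms by (intro indep_vars_PiM_component prob_space_gauss) auto
  then have "indep_vars (\<lambda>_. borel) (\<lambda>j x. x j $ i) {..<n}"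
    by (rule indep_vars_compose2) simp
  then have "distributed (samples n \<theta>) lborel (\<lambda>x. \<Sum>j<n. x j $ i)
      (normal_density (\<Sum>j<n. \<theta> $ i) (sqrt (\<Sum>j<n. 1\<^sup>2)))"
    using assms by (intro sum_indep_normal distributed_samples_component) auto
  then have "distributed (samples n \<theta>) lborel (\<lambda>x. 0 + 1 / real n * (\<Sum>j<n. x j $ i))
      (normal_density (0 + 1 / real n * (real n * \<theta> $ i)) (\<bar>1 / real n\<bar> * sqrt (real n)))"
    using assms by (intro normal_density_affine) auto
  moreover have "\<bar>1 / real n\<bar> * sqrt (real n) = 1 / sqrt (real n)"
    using assms by (simp add: field_simps)
  ultimately show ?thesis
    using assms by (simp add: sample_mean_def)
qed

lemma nn_integral_samples_norm_power2:
  fixes f :: "(nat \<Rightarrow> real ^ 'd) \<Rightarrow> real ^ 'd"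
  assumes [measurable]: "f \<in> borel_measurable (sample_space n)"
  shows "(\<integral>\<^sup>+x. ennreal ((norm (f x))\<^sup>2) \<partial>samples n \<theta>)
      = (\<Sum>i\<in>UNIV. \<integral>\<^sup>+x. ennreal ((f x $ i)\<^sup>2) \<partial>samples n \<theta>)"
proof -
  have [measurable]: "(\<lambda>x. f x $ i) \<in> borel_measurable (sample_space n)" for i
    by (rule measurable_compose[OF assms]) simp
  show ?thesis
    by (simp add: norm_power2_vec nn_integral_sum flip: sum_ennreal)
qed

lemma nn_integral_sample_mean_error:
  fixes \<theta> :: "real ^ 'd"
  assumes "0 < n"
  shows "(\<integral>\<^sup>+x. ennreal ((norm (sample_mean n x - \<theta>))\<^sup>2) \<partial>samples n \<theta>)
      = ennreal (real CARD('d) / real n)"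
proof -
  have "(\<integral>\<^sup>+x. ennreal ((sample_mean n x $ i - \<theta> $ i)\<^sup>2) \<partial>samples n \<theta>) = ennreal (1 / real n)" for i
  proof -
    have "(\<integral>\<^sup>+x. ennreal ((sample_mean n x $ i - \<theta> $ i)\<^sup>2) \<partial>samples n \<theta>)
        = (\<integral>\<^sup>+y. ennreal (normal_density (\<theta> $ i) (1 / sqrt (real n)) y) * ennreal ((y - \<theta> $ i)\<^sup>2) \<partial>lborel)"
      by (rule distributed_nn_integral[OF distributed_sample_mean_component[OF assms], symmetric]) measurable
    then show ?thesis
      using assms by (simp add: nn_integral_normal_density_variance power_divide flip: ennreal_mult)
  qed
  then show ?thesis
    by (simp add: nn_integral_samples_norm_power2 ennreal_of_nat_eq_real_of_nat flip: ennreal_mult)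
qed

lemma sample_mean_deviation_le:
  fixes \<theta> :: "real ^ 'd"
  assumes "0 < r" "0 < n"
  shows "measure (samples n \<theta>) {x \<in> space (samples n \<theta>). r \<le> norm (sample_mean n x - \<theta>)}
     \<le> real CARD('d) / (real n * r\<^sup>2)"
proof -
  interpret prob_space "samples n \<theta>"
    by (rule prob_space_samples)
  let ?e = "\<lambda>x. ennreal ((norm (sample_mean n x - \<theta>))\<^sup>2)"
  have "1 \<le> ennreal (1 / r\<^sup>2) * ?e x" if "r \<le> norm (sample_mean n x - \<theta>)" for x
  proof -
    have "r\<^sup>2 \<le> (norm (sample_mean n x - \<theta>))\<^sup>2"
      using that \<open>0 < r\<close> by (intro power_mono) auto
    then show ?thesis
      using \<open>0 < r\<close> by (simp add: field_simps flip: ennreal_mult)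
  qed
  then have "emeasure (samples n \<theta>) {x \<in> space (samples n \<theta>). r \<le> norm (sample_mean n x - \<theta>)}
      \<le> emeasure (samples n \<theta>) {x \<in> space (samples n \<theta>). 1 \<le> ennreal (1 / r\<^sup>2) * ?e x}"
    by (intro emeasure_mono subsetI; (measurable | blast))
  also have "\<dots> \<le> ennreal (1 / r\<^sup>2) * (\<integral>\<^sup>+x. ?e x * indicator (space (samples n \<theta>)) x \<partial>samples n \<theta>)"
    by (rule nn_integral_Markov_inequality) measurable
  also have "\<dots> = ennreal (1 / r\<^sup>2) * (\<integral>\<^sup>+x. ?e x \<partial>samples n \<theta>)"
    by (intro arg_cong2[where f = "(*)"] nn_integral_cong) auto
  also have "\<dots> = ennreal (real CARD('d) / (real n * r\<^sup>2))"
    using \<open>0 < n\<close> by (simp add: nn_integral_sample_mean_error mult.commute flip: ennreal_mult)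
  finally show ?thesis
    by (simp add: emeasure_eq_measure)
qed

section \<open>Goodness-of-fit testing\<close>

lemma gof_ok_exists:
  fixes \<Gamma> :: "(real ^ 'd) set"
  assumes "0 < \<delta>"
  shows "\<exists>n. gof_ok \<Gamma> \<delta> n"
proof -
  obtain n where n: "16 * real CARD('d) / \<delta>\<^sup>2 < real n"
    using reals_Archimedean2 by blast
  moreover have "0 < 16 * real CARD('d) / \<delta>\<^sup>2"
    using assms by simp
  ultimately have "0 < n"
    by (intro gr0I) auto
  have "real CARD('d) / (real n * (\<delta> / 2)\<^sup>2) \<le> 1/4"
    using n \<open>0 < n\<close> assms by (simp add: power_divide field_simps)
  then have deviation:
    "measure (samples n \<theta>) {x \<in> space (samples n \<theta>). \<delta> / 2 \<le> norm (sample_mean n x - \<theta>)} \<le> 1/4"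
    for \<theta> :: "real ^ 'd"
    using sample_mean_deviation_le[of "\<delta> / 2" n \<theta>] assms \<open>0 < n\<close> by linarith
  let ?\<psi> = "\<lambda>x :: nat \<Rightarrow> real ^ 'd. \<delta> / 2 \<le> norm (sample_mean n x)"
  have "measure (samples n \<theta>) {x \<in> space (samples n \<theta>). \<not> ?\<psi> x} \<le> 1/4" if "\<delta> \<le> norm \<theta>" for \<theta>
  proof -
    interpret prob_space "samples n \<theta>"
      by (rule prob_space_samples)
    have "\<delta> / 2 \<le> norm (sample_mean n x - \<theta>)" if "\<not> ?\<psi> x" for x
      using that \<open>\<delta> \<le> norm \<theta>\<close> norm_triangle_ineq2[of \<theta> "sample_mean n x"]
      by (simp add: norm_minus_commute)
    then have "measure (samples n \<theta>) {x \<in> space (samples n \<theta>). \<not> ?\<psi> x}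
        \<le> measure (samples n \<theta>) {x \<in> space (samples n \<theta>). \<delta> / 2 \<le> norm (sample_mean n x - \<theta>)}"
      by (intro finite_measure_mono subsetI; (measurable | blast))
    then show ?thesis
      using deviation[of \<theta>] by linarith
  qed
  moreover have "measure (samples n 0) {x \<in> space (samples n 0). ?\<psi> x} \<le> 1/4"
    using deviation[of 0] by simp
  moreover have "?\<psi> \<in> measurable (sample_space n) (count_space UNIV)"
    by measurable
  ultimately show ?thesis
    unfolding gof_ok_def by blast
qed

lemma gof_ok_rejection_region:
  assumes "gof_ok \<Gamma> \<delta> n"
  obtains E where "E \<in> sets (sample_space n)" "emeasure (samples n 0) E \<le> ennreal (1/4)"
    "\<And>\<theta>. \<theta> \<in> \<Gamma> \<Longrightarrow> \<delta> \<le> norm \<theta> \<Longrightarrow> ennreal (3/4) \<le> emeasure (samples n \<theta>) E"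
proof -
  obtain \<psi> where [measurable]: "\<psi> \<in> measurable (sample_space n) (count_space UNIV)"
    and type_I: "measure (samples n 0) {x \<in> space (samples n 0). \<psi> x} \<le> 1/4"
    and type_II: "\<And>\<theta>. \<theta> \<in> \<Gamma> \<Longrightarrow> \<delta> \<le> norm \<theta> \<Longrightarrow>
      measure (samples n \<theta>) {x \<in> space (samples n \<theta>). \<not> \<psi> x} \<le> 1/4"
    using assms unfolding gof_ok_def by blast
  define E where "E = {x \<in> space (sample_space n). \<psi> x}"
  interpret prob_space "samples n \<theta>" for \<theta>
    by (rule prob_space_samples)
  have E [measurable]: "E \<in> sets (sample_space n)"
    unfolding E_def by measurable
  show thesis
  proof (rule that[OF E])
    show "emeasure (samples n 0) E \<le> ennreal (1/4)"
      using type_I by (simp add: emeasure_eq_measure E_def space_samples)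
  next
    fix \<theta> assume "\<theta> \<in> \<Gamma>" "\<delta> \<le> norm \<theta>"
    have "{x \<in> space (samples n \<theta>). \<not> \<psi> x} = space (samples n \<theta>) - E"
      by (auto simp: E_def space_samples)
    then have "3/4 \<le> measure (samples n \<theta>) E"
      using type_II[OF \<open>\<theta> \<in> \<Gamma>\<close> \<open>\<delta> \<le> norm \<theta>\<close>] prob_compl[of E \<theta>] by simp
    then show "ennreal (3/4) \<le> emeasure (samples n \<theta>) E"
      by (simp add: emeasure_eq_measure)
  qed
qed

definition flip_signs :: "('d \<Rightarrow> real) \<Rightarrow> real ^ 'd \<Rightarrow> real ^ 'd" where
  "flip_signs s \<theta> = (\<chi> i. s i * \<theta> $ i)"

lemma orthosymmetricD:
  assumes "orthosymmetric \<Gamma>" "\<theta> \<in> \<Gamma>" "\<And>i. s i \<in> {-1, 1}"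
  shows "flip_signs s \<theta> \<in> \<Gamma>"
  using assms unfolding orthosymmetric_def flip_signs_def by blast

lemma norm_flip_signs:
  assumes "\<And>i. s i \<in> {-1, 1}"
  shows "norm (flip_signs s \<theta>) = norm \<theta>"
proof -
  have "(s i)\<^sup>2 = 1" for i
    using assms[of i] by auto
  then have "(norm (flip_signs s \<theta>))\<^sup>2 = (norm \<theta>)\<^sup>2"
    by (simp add: norm_power2_vec flip_signs_def power_mult_distrib)
  then show ?thesis
    by simp
qed

lemma sum_exp_inner_flip_signs_le:
  fixes \<theta> :: "real ^ 'd"
  assumes "\<And>i. s i \<in> {-1, 1}"
  shows "(\<Sum>t\<in>UNIV \<rightarrow>\<^sub>E {-1, 1}. exp (r * (flip_signs s \<theta> \<bullet> flip_signs t \<theta>)))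
     \<le> 2 ^ CARD('d) * exp (r\<^sup>2 * (\<Sum>i\<in>UNIV. (\<theta> $ i) ^ 4) / 2)"
proof -
  have s: "(s i)\<^sup>2 = 1" for i
    using assms[of i] by auto
  let ?c = "\<lambda>i. r * s i * (\<theta> $ i)\<^sup>2"
  have "(\<Sum>t\<in>UNIV \<rightarrow>\<^sub>E {-1, 1}. exp (r * (flip_signs s \<theta> \<bullet> flip_signs t \<theta>)))
      = (\<Sum>t\<in>UNIV \<rightarrow>\<^sub>E {-1, 1}. exp (\<Sum>i\<in>UNIV. t i * ?c i))"
    by (simp add: flip_signs_def inner_vec_def sum_distrib_left power2_eq_square mult_ac)
  also have "\<dots> = 2 ^ CARD('d) * (\<Prod>i\<in>UNIV. cosh (?c i))"
    by (simp add: sum_exp_signs_eq_prod_cosh)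
  also have "\<dots> \<le> 2 ^ CARD('d) * (\<Prod>i\<in>UNIV. exp ((?c i)\<^sup>2 / 2))"
    by (intro mult_left_mono prod_mono) (auto intro: cosh_le_exp_power2_half)
  also have "(\<Prod>i\<in>UNIV. exp ((?c i)\<^sup>2 / 2)) = exp (r\<^sup>2 * (\<Sum>i\<in>UNIV. (\<theta> $ i) ^ 4) / 2)"
    by (simp add: power_mult_distrib s sum_distrib_left sum_divide_distrib flip: exp_sum)
  finally show ?thesis .
qed

lemma gof_ok_imp_sum_power4_ge:
  fixes \<theta> :: "real ^ 'd"
  assumes gof: "gof_ok \<Gamma> \<delta> n" and ortho: "orthosymmetric \<Gamma>"
    and \<theta>: "\<theta> \<in> \<Gamma>" "\<delta> \<le> norm \<theta>"
  shows "1 \<le> (real n)\<^sup>2 * (\<Sum>i\<in>UNIV. (\<theta> $ i) ^ 4)"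
proof -
  define S where "S = (UNIV :: 'd set) \<rightarrow>\<^sub>E {-1, 1 :: real}"
  let ?L = "\<lambda>s x. ennreal (likelihood_ratio n (flip_signs s \<theta>) x)"
  let ?Q = "(real n)\<^sup>2 * (\<Sum>i\<in>UNIV. (\<theta> $ i) ^ 4)"
  have sign: "s i \<in> {-1, 1}" if "s \<in> S" for s i
    using that by (auto simp: S_def)
  have card_S: "card S = 2 ^ CARD('d)"
    unfolding S_def by (simp add: card_PiE numeral_2_eq_2)
  obtain E where [measurable]: "E \<in> sets (sample_space n)"
    and null: "emeasure (samples n 0) E \<le> ennreal (1/4)"
    and power: "\<And>\<theta>. \<theta> \<in> \<Gamma> \<Longrightarrow> \<delta> \<le> norm \<theta> \<Longrightarrow> ennreal (3/4) \<le> emeasure (samples n \<theta>) E"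
    using gof_ok_rejection_region[OF gof] by blast
  have "ennreal (3/4) \<le> emeasure (density (samples n 0) (?L s)) E" if "s \<in> S" for s
    using that sign orthosymmetricD[OF ortho \<theta>(1)] norm_flip_signs[of s \<theta>] \<theta>(2)
    by (simp add: power flip: samples_eq_density)
  then have "(of_nat (card S) * ennreal (3/4))\<^sup>2
      \<le> (\<Sum>s\<in>S. \<Sum>t\<in>S. \<integral>\<^sup>+x. ?L s x * ?L t x \<partial>samples n 0) * emeasure (samples n 0) E"
    by (intro mixture_power_le_second_moment) simp_all
  also have "\<dots> \<le> (\<Sum>s\<in>S. \<Sum>t\<in>S. \<integral>\<^sup>+x. ?L s x * ?L t x \<partial>samples n 0) * ennreal (1/4)"
    using null by (intro mult_left_mono) auto
  also have "\<dots> = ennreal ((\<Sum>s\<in>S. \<Sum>t\<in>S. exp (real n * (flip_signs s \<theta> \<bullet> flip_signs t \<theta>))) * (1/4))"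
    unfolding nn_integral_likelihood_ratio_mult by (simp add: sum_nonneg flip: ennreal_mult)
  also have "\<dots> \<le> ennreal ((\<Sum>s\<in>S. 2 ^ CARD('d) * exp (?Q / 2)) * (1/4))"
    unfolding S_def using sign[unfolded S_def]
    by (intro ennreal_leI mult_right_mono sum_mono sum_exp_inner_flip_signs_le) auto
  finally have "(2 ^ CARD('d) * (3/4))\<^sup>2 \<le> 2 ^ CARD('d) * (2 ^ CARD('d) * exp (?Q / 2)) * (1/4)"
    by (simp add: card_S ennreal_of_nat_eq_real_of_nat ennreal_power flip: ennreal_mult)
  then have "9/4 \<le> exp (?Q / 2)"
    by (simp add: power2_eq_square field_simps)
  then have "exp (1/2) < exp (?Q / 2)"
    using exp_1_half_less by linarith
  then show ?thesis
    by simp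
qed

lemma orthosymmetric_convex_solid:
  fixes \<theta> u :: "real ^ 'd"
  assumes ortho: "orthosymmetric \<Gamma>" and conv: "convex \<Gamma>" and "\<theta> \<in> \<Gamma>"
    and dominated: "\<And>i. \<bar>u $ i\<bar> \<le> \<bar>\<theta> $ i\<bar>"
  shows "u \<in> \<Gamma>"
proof -
  have "(\<chi> i. if i \<in> S then u $ i else \<theta> $ i) \<in> \<Gamma>" if "finite S" for S :: "'d set"
    using that
  proof (induction S)
    case empty
    then show ?case
      using \<open>\<theta> \<in> \<Gamma>\<close> by (simp add: vec_lambda_eta)
  next
    case (insert k S)
    let ?v = "\<chi> i. if i \<in> S then u $ i else \<theta> $ i"
    let ?w = "flip_signs (\<lambda>i. if i = k then -1 else 1) ?v"
    define c where "c = (if \<theta> $ k = 0 then 0 else u $ k / \<theta> $ k)"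
    have c: "\<bar>c\<bar> \<le> 1" "c * \<theta> $ k = u $ k"
      using dominated[of k] by (auto simp: c_def)
    have "?w \<in> \<Gamma>"
      using insert.IH by (intro orthosymmetricD[OF ortho]) auto
    then have "((1 + c) / 2) *\<^sub>R ?v + ((1 - c) / 2) *\<^sub>R ?w \<in> \<Gamma>"
      using c(1) by (intro convexD[OF conv insert.IH]) (auto simp: field_simps)
    also have "((1 + c) / 2) *\<^sub>R ?v + ((1 - c) / 2) *\<^sub>R ?w
        = (\<chi> i. if i \<in> insert k S then u $ i else \<theta> $ i)"
      using insert.hyps c(2) by (auto simp: flip_signs_def vec_eq_iff field_simps)
    finally show ?case .
  qed
  from this[of UNIV] show ?thesis
    by (simp add: vec_lambda_eta)
qed

lemma orthosymmetric_convex_shrink: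
  assumes "orthosymmetric \<Gamma>" "convex \<Gamma>" "\<theta> \<in> \<Gamma>" "0 < \<delta>" "\<delta> \<le> norm \<theta>"
  obtains w where "w \<in> \<Gamma>" "norm w = \<delta>" "\<And>i. \<bar>w $ i\<bar> \<le> \<bar>\<theta> $ i\<bar>"
proof
  let ?w = "(\<delta> / norm \<theta>) *\<^sub>R \<theta>"
  have pos: "0 < norm \<theta>"
    using assms(4,5) by linarith
  then show "norm ?w = \<delta>"
    using assms(4) by simp
  show le: "\<bar>?w $ i\<bar> \<le> \<bar>\<theta> $ i\<bar>" for i
    using pos assms(4,5) by (simp add: abs_mult field_simps mult_right_mono)
  show "?w \<in> \<Gamma>"
    using orthosymmetric_convex_solid[OF assms(1-3) le] .
qed

lemma sum_power4_le_norm: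
  fixes w :: "real ^ 'd"
  assumes "\<And>i. \<bar>w $ i\<bar> \<le> T"
  shows "(\<Sum>i\<in>UNIV. (w $ i) ^ 4) \<le> T\<^sup>2 * (norm w)\<^sup>2"
proof -
  have "(w $ i) ^ 4 \<le> T\<^sup>2 * (w $ i)\<^sup>2" for i
  proof -
    have "(w $ i)\<^sup>2 \<le> T\<^sup>2"
      using power_mono[OF assms[of i], of 2] by simp
    then have "(w $ i)\<^sup>2 * (w $ i)\<^sup>2 \<le> T\<^sup>2 * (w $ i)\<^sup>2"
      by (intro mult_right_mono) auto
    then show ?thesis
      by (simp flip: power_add)
  qed
  then show ?thesis
    by (simp add: norm_power2_vec sum_distrib_left sum_mono)
qed

lemma gof_ok_imp_component_bound_ge:
  fixes \<theta> :: "real ^ 'd"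
  assumes gof: "gof_ok \<Gamma> \<delta> n" and \<Gamma>: "orthosymmetric \<Gamma>" "convex \<Gamma>" and "0 < \<delta>"
    and \<theta>: "\<theta> \<in> \<Gamma>" "\<delta> \<le> norm \<theta>" "\<And>i. \<bar>\<theta> $ i\<bar> \<le> T"
  shows "1 \<le> (real n)\<^sup>2 * T\<^sup>2 * \<delta>\<^sup>2"
proof -
  obtain w where w: "w \<in> \<Gamma>" "norm w = \<delta>" "\<And>i. \<bar>w $ i\<bar> \<le> \<bar>\<theta> $ i\<bar>"
    using orthosymmetric_convex_shrink[OF \<Gamma> \<theta>(1) \<open>0 < \<delta>\<close> \<theta>(2)] by blast
  have "1 \<le> (real n)\<^sup>2 * (\<Sum>i\<in>UNIV. (w $ i) ^ 4)"
    using w by (intro gof_ok_imp_sum_power4_ge[OF gof \<Gamma>(1)]) auto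
  also have "\<dots> \<le> (real n)\<^sup>2 * (T\<^sup>2 * \<delta>\<^sup>2)"
    using sum_power4_le_norm[of w T] w \<theta>(3) by (intro mult_left_mono) (auto intro: order_trans)
  finally show ?thesis
    by (simp add: mult.assoc)
qed

lemma gof_ok_imp_sum_min_less:
  fixes \<theta> :: "real ^ 'd"
  assumes gof: "gof_ok \<Gamma> \<delta> n" and \<Gamma>: "orthosymmetric \<Gamma>" "convex \<Gamma>" and "0 < \<delta>" "\<theta> \<in> \<Gamma>"
    and t: "0 \<le> t" "(real n)\<^sup>2 * t * \<delta>\<^sup>2 < 1"
  shows "(\<Sum>i\<in>UNIV. min ((\<theta> $ i)\<^sup>2) t) < \<delta>\<^sup>2"
proof -
  define T where "T = sqrt t"
  have T: "0 \<le> T" "t = T\<^sup>2"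
    using t(1) by (simp_all add: T_def)
  define v where "v = (\<chi> i. min \<bar>\<theta> $ i\<bar> T)"
  have "v \<in> \<Gamma>"
    using T(1) by (intro orthosymmetric_convex_solid[OF \<Gamma> \<open>\<theta> \<in> \<Gamma>\<close>]) (auto simp: v_def)
  moreover have "\<bar>v $ i\<bar> \<le> T" for i
    using T(1) by (auto simp: v_def)
  ultimately have "norm v < \<delta>"
    using gof_ok_imp_component_bound_ge[OF gof \<Gamma> \<open>0 < \<delta>\<close>, of v T] t(2) unfolding T(2) by fastforce
  then have "(norm v)\<^sup>2 < \<delta>\<^sup>2"
    by (intro power_strict_mono) auto
  moreover have "min ((\<theta> $ i)\<^sup>2) (T\<^sup>2) = (v $ i)\<^sup>2" for i
    using T(1) abs_le_square_iff[of "\<theta> $ i" T] by (auto simp: v_def min_def)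
  ultimately show ?thesis
    by (simp add: norm_power2_vec T(2))
qed

lemma gof_ok_imp_norm_less:
  fixes \<theta> :: "real ^ 'd"
  assumes gof: "gof_ok \<Gamma> \<delta> n" and \<Gamma>: "orthosymmetric \<Gamma>" "convex \<Gamma>" and "0 < \<delta>" "\<theta> \<in> \<Gamma>"
    and small: "(real n)\<^sup>2 * \<delta>\<^sup>2 * \<delta>\<^sup>2 < 1"
  shows "norm \<theta> < \<delta>"
proof (rule ccontr)
  assume "\<not> norm \<theta> < \<delta>"
  then obtain w where "w \<in> \<Gamma>" "norm w = \<delta>"
    using orthosymmetric_convex_shrink[OF \<Gamma> \<open>\<theta> \<in> \<Gamma>\<close> \<open>0 < \<delta>\<close>] by (metis not_less)
  then have "1 \<le> (real n)\<^sup>2 * \<delta>\<^sup>2 * \<delta>\<^sup>2"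
    using component_le_norm_cart[of w]
    by (intro gof_ok_imp_component_bound_ge[OF gof \<Gamma> \<open>0 < \<delta>\<close>, of w]) auto
  with small show False
    by simp
qed

section \<open>Estimation by soft thresholding\<close>

definition soft_threshold :: "real \<Rightarrow> real \<Rightarrow> real" where
  "soft_threshold \<tau> y = y - max (- \<tau>) (min \<tau> y)"

lemma borel_measurable_soft_threshold [measurable]: "soft_threshold \<tau> \<in> borel_measurable borel"
  unfolding soft_threshold_def by measurable

lemma soft_threshold_error_le:
  assumes "0 \<le> \<tau>"
  shows "(soft_threshold \<tau> y - \<mu>)\<^sup>2
     \<le> min (\<mu>\<^sup>2) ((2 * \<tau>)\<^sup>2) + 4 * ((y - \<mu>)\<^sup>2 * indicator {y. \<tau> < \<bar>y - \<mu>\<bar>} y)"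
proof (cases "\<tau> < \<bar>y - \<mu>\<bar>")
  case True
  then have "\<bar>soft_threshold \<tau> y - \<mu>\<bar> \<le> \<bar>2 * (y - \<mu>)\<bar>"
    using assms by (auto simp: soft_threshold_def max_def min_def)
  then have "(soft_threshold \<tau> y - \<mu>)\<^sup>2 \<le> 4 * (y - \<mu>)\<^sup>2"
    unfolding abs_le_square_iff power_mult_distrib by simp
  with True show ?thesis
    by (auto intro: add_increasing)
next
  case False
  then have "\<bar>soft_threshold \<tau> y - \<mu>\<bar> \<le> \<bar>\<mu>\<bar>" "\<bar>soft_threshold \<tau> y - \<mu>\<bar> \<le> \<bar>2 * \<tau>\<bar>"
    using assms by (auto simp: soft_threshold_def)
  then show ?thesis
    unfolding abs_le_square_iff using False by simp
qed

lemma soft_threshold_normal_risk_le: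
  assumes X: "distributed M lborel X (normal_density \<mu> \<sigma>)" and "0 < \<sigma>" "0 \<le> \<tau>"
  shows "(\<integral>\<^sup>+x. ennreal ((soft_threshold \<tau> (X x) - \<mu>)\<^sup>2) \<partial>M)
     \<le> ennreal (min (\<mu>\<^sup>2) ((2 * \<tau>)\<^sup>2) + 8 * sqrt 2 * \<sigma>\<^sup>2 * exp (- (\<tau>\<^sup>2 / (4 * \<sigma>\<^sup>2))))"
proof -
  let ?\<phi> = "normal_density \<mu> \<sigma>"
  let ?b = "min (\<mu>\<^sup>2) ((2 * \<tau>)\<^sup>2)"
  let ?tail = "\<lambda>y. (y - \<mu>)\<^sup>2 * indicator {y. \<tau> < \<bar>y - \<mu>\<bar>} y"
  have "(\<integral>\<^sup>+x. ennreal ((soft_threshold \<tau> (X x) - \<mu>)\<^sup>2) \<partial>M)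
      = (\<integral>\<^sup>+y. ennreal (?\<phi> y) * ennreal ((soft_threshold \<tau> y - \<mu>)\<^sup>2) \<partial>lborel)"
    by (rule distributed_nn_integral[OF X, symmetric]) measurable
  also have "\<dots> \<le> (\<integral>\<^sup>+y. ennreal (?\<phi> y) * ennreal (?b + 4 * ?tail y) \<partial>lborel)"
    using soft_threshold_error_le[OF \<open>0 \<le> \<tau>\<close>]
    by (intro nn_integral_mono mult_left_mono ennreal_leI) auto
  also have "\<dots> = (\<integral>\<^sup>+y. ennreal ?b * ennreal (?\<phi> y) + 4 * ennreal (?\<phi> y * ?tail y) \<partial>lborel)"
    by (intro nn_integral_cong)
      (simp add: ennreal_mult distrib_left mult_ac)
  also have "\<dots> = ennreal ?b + 4 * (\<integral>\<^sup>+y. ennreal (?\<phi> y * ?tail y) \<partial>lborel)"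
    using \<open>0 < \<sigma>\<close> by (simp add: nn_integral_add nn_integral_cmult nn_integral_normal_density)
  also have "\<dots> \<le> ennreal ?b + 4 * ennreal (2 * sqrt 2 * \<sigma>\<^sup>2 * exp (- (\<tau>\<^sup>2 / (4 * \<sigma>\<^sup>2))))"
    using assms by (intro add_left_mono mult_left_mono nn_integral_normal_density_tail_le) auto
  also have "\<dots> = ennreal (?b + 8 * sqrt 2 * \<sigma>\<^sup>2 * exp (- (\<tau>\<^sup>2 / (4 * \<sigma>\<^sup>2))))"
    by (simp add: ennreal_mult mult.assoc)
  finally show ?thesis .
qed

definition soft_threshold_estimator :: "real \<Rightarrow> nat \<Rightarrow> (nat \<Rightarrow> real ^ 'd) \<Rightarrow> real ^ 'd" where
  "soft_threshold_estimator \<tau> n x = (\<chi> i. soft_threshold \<tau> (sample_mean n x $ i))"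

lemma measurable_soft_threshold_estimator [measurable]:
  "soft_threshold_estimator \<tau> n \<in> borel_measurable (sample_space n :: (nat \<Rightarrow> real ^ 'd) measure)"
proof -
  have "continuous_on UNIV (\<lambda>v :: real ^ 'd. \<chi> i. soft_threshold \<tau> (v $ i))"
    unfolding soft_threshold_def by (intro continuous_intros)
  then show ?thesis
    unfolding soft_threshold_estimator_def
    by (intro measurable_compose[OF measurable_sample_mean] borel_measurable_continuous_onI)
qed

lemma soft_threshold_estimator_risk_le:
  fixes \<theta> :: "real ^ 'd"
  assumes "0 < n" "0 \<le> \<tau>"
  shows "(\<integral>\<^sup>+x. ennreal ((norm (soft_threshold_estimator \<tau> n x - \<theta>))\<^sup>2) \<partial>samples n \<theta>)
     \<le> ennreal ((\<Sum>i\<in>UNIV. min ((\<theta> $ i)\<^sup>2) ((2 * \<tau>)\<^sup>2))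
         + 8 * sqrt 2 * real CARD('d) / real n * exp (- (real n * \<tau>\<^sup>2 / 4)))"
proof -
  let ?r = "8 * sqrt 2 / real n * exp (- (real n * \<tau>\<^sup>2 / 4))"
  have "(\<integral>\<^sup>+x. ennreal ((norm (soft_threshold_estimator \<tau> n x - \<theta>))\<^sup>2) \<partial>samples n \<theta>)
      = (\<Sum>i\<in>UNIV. \<integral>\<^sup>+x. ennreal ((soft_threshold \<tau> (sample_mean n x $ i) - \<theta> $ i)\<^sup>2) \<partial>samples n \<theta>)"
    by (subst nn_integral_samples_norm_power2, measurable) (simp add: soft_threshold_estimator_def)
  also have "\<dots> \<le> (\<Sum>i\<in>UNIV. ennreal (min ((\<theta> $ i)\<^sup>2) ((2 * \<tau>)\<^sup>2) + ?r))"
  proof (rule sum_mono)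
    fix i
    show "(\<integral>\<^sup>+x. ennreal ((soft_threshold \<tau> (sample_mean n x $ i) - \<theta> $ i)\<^sup>2) \<partial>samples n \<theta>)
        \<le> ennreal (min ((\<theta> $ i)\<^sup>2) ((2 * \<tau>)\<^sup>2) + ?r)"
      using soft_threshold_normal_risk_le[OF distributed_sample_mean_component[OF \<open>0 < n\<close>] _ \<open>0 \<le> \<tau>\<close>]
        \<open>0 < n\<close>
      by (simp add: power_divide mult_ac)
  qed
  also have "\<dots> = ennreal ((\<Sum>i\<in>UNIV. min ((\<theta> $ i)\<^sup>2) ((2 * \<tau>)\<^sup>2)) + real CARD('d) * ?r)"
    by (subst sum_ennreal) (auto simp: sum.distrib)
  finally show ?thesis
    by (simp add: mult_ac)
qed

lemma est_ok_if_sum_min_log_le: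
  fixes \<Gamma> :: "(real ^ 'd) set"
  assumes "0 < n"
    and "\<And>\<theta>. \<theta> \<in> \<Gamma> \<Longrightarrow>
      (\<Sum>i\<in>UNIV. min ((\<theta> $ i)\<^sup>2) (64 * ln (2 * real CARD('d)) / real n)) + 1 / real n \<le> \<epsilon>\<^sup>2"
  shows "est_ok \<Gamma> \<epsilon> n"
proof -
  let ?D = "real CARD('d)"
  define \<tau> where "\<tau> = 4 * sqrt (ln (2 * ?D) / real n)"
  have D: "1 \<le> ?D"
    by simp
  have "0 \<le> ln (2 * ?D)"
    using half_less_ln_double[OF D] by linarith
  then have \<tau>: "0 \<le> \<tau>" "(2 * \<tau>)\<^sup>2 = 64 * ln (2 * ?D) / real n" "real n * \<tau>\<^sup>2 / 4 = 4 * ln (2 * ?D)"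
    using \<open>0 < n\<close> by (simp_all add: \<tau>_def power_mult_distrib)
  have "8 * sqrt 2 * ?D * exp (- (real n * \<tau>\<^sup>2 / 4)) \<le> 1"
    unfolding \<tau>(3) using D by (rule exp_minus_4_ln_double_le)
  then have tail: "8 * sqrt 2 * ?D / real n * exp (- (real n * \<tau>\<^sup>2 / 4)) \<le> 1 / real n"
    using divide_right_mono[of _ 1 "real n"] by simp
  show ?thesis
    unfolding est_ok_def
  proof (intro exI[of _ "soft_threshold_estimator \<tau> n"] conjI ballI)
    fix \<theta> assume "\<theta> \<in> \<Gamma>"
    then have "(\<Sum>i\<in>UNIV. min ((\<theta> $ i)\<^sup>2) ((2 * \<tau>)\<^sup>2))
        + 8 * sqrt 2 * ?D / real n * exp (- (real n * \<tau>\<^sup>2 / 4)) \<le> \<epsilon>\<^sup>2"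
      using assms(2)[of \<theta>] tail unfolding \<tau>(2) by linarith
    then show "(\<integral>\<^sup>+x. ennreal ((norm (soft_threshold_estimator \<tau> n x - \<theta>))\<^sup>2) \<partial>samples n \<theta>)
        \<le> ennreal (\<epsilon>\<^sup>2)"
      by (intro order_trans[OF soft_threshold_estimator_risk_le[OF \<open>0 < n\<close> \<tau>(1)]] ennreal_leI)
  qed measurable
qed

lemma est_ok_0:
  assumes "\<And>\<theta>. \<theta> \<in> \<Gamma> \<Longrightarrow> norm \<theta> \<le> \<epsilon>"
  shows "est_ok \<Gamma> \<epsilon> 0"
  unfolding est_ok_def
proof (intro exI[of _ "\<lambda>_. 0"] conjI ballI)
  fix \<theta> assume "\<theta> \<in> \<Gamma>"
  then have "(norm \<theta>)\<^sup>2 \<le> \<epsilon>\<^sup>2"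
    using assms by (intro power_mono) auto
  then show "(\<integral>\<^sup>+x. ennreal ((norm (0 - \<theta>))\<^sup>2) \<partial>samples 0 \<theta>) \<le> ennreal (\<epsilon>\<^sup>2)"
    by (simp add: prob_space.emeasure_space_1[OF prob_space_samples] ennreal_leI)
qed simp

lemma obtain_sample_size:
  fixes L \<epsilon> :: real and n :: nat
  assumes "1/2 \<le> L" and n: "4 \<le> (real n)\<^sup>2 * \<epsilon>\<^sup>2 * \<epsilon>\<^sup>2"
  obtains m where "0 < m" "real m \<le> 64 * L * ((real n)\<^sup>2 * \<epsilon>\<^sup>2)"
    "(real n)\<^sup>2 * (64 * L / real m) * (\<epsilon>\<^sup>2 / 2) < 1" "1 / real m \<le> \<epsilon>\<^sup>2 / 2"
proof -
  define X where "X = (real n)\<^sup>2 * \<epsilon>\<^sup>2"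
  have "2 \<le> X"
  proof (rule power2_le_imp_le)
    have "n \<noteq> 0"
      using n by (intro notI) simp
    then have "1 * 4 \<le> (real n)\<^sup>2 * ((real n)\<^sup>2 * \<epsilon>\<^sup>2 * \<epsilon>\<^sup>2)"
      using n by (intro mult_mono) auto
    then show "2\<^sup>2 \<le> X\<^sup>2"
      by (simp add: X_def power2_eq_square mult_ac)
  qed (simp add: X_def)
  then have LX: "1/2 * 2 \<le> L * X"
    using assms(1) by (intro mult_mono) auto
  \<comment> \<open>The two bounds on \<open>m\<close> differ by a factor of two, which absorbs the rounding.\<close>
  define m where "m = nat \<lfloor>64 * L * X\<rfloor>"
  have m: "real m \<le> 64 * L * X" "32 * L * X < real m"
    using LX unfolding m_def by linarith+
  then have "0 < m"
    using LX by (intro gr0I) simp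
  have "1/2 * 4 \<le> L * (X * \<epsilon>\<^sup>2)"
    using assms by (intro mult_mono) (auto simp: X_def)
  then have "2 \<le> 32 * L * X * \<epsilon>\<^sup>2"
    by (simp add: mult.assoc)
  also have "\<dots> \<le> real m * \<epsilon>\<^sup>2"
    using m(2) by (intro mult_right_mono) auto
  finally have "1 / real m \<le> \<epsilon>\<^sup>2 / 2"
    using \<open>0 < m\<close> by (simp add: field_simps)
  moreover have "(real n)\<^sup>2 * (64 * L / real m) * (\<epsilon>\<^sup>2 / 2) < 1"
    using m(2) \<open>0 < m\<close> by (simp add: X_def field_simps)
  ultimately show thesis
    using that \<open>0 < m\<close> m(1) unfolding X_def by blast
qed

lemma gof_ok_imp_est_ok:
  fixes \<Gamma> :: "(real ^ 'd) set"
  assumes gof: "gof_ok \<Gamma> (\<epsilon> / sqrt 2) n" and \<Gamma>: "orthosymmetric \<Gamma>" "convex \<Gamma>" and "0 < \<epsilon>"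
  obtains m where "est_ok \<Gamma> \<epsilon> m" "real m \<le> 64 * ln (2 * real CARD('d)) * ((real n)\<^sup>2 * \<epsilon>\<^sup>2)"
proof -
  define L where "L = ln (2 * real CARD('d))"
  have L: "1/2 < L"
    unfolding L_def by (rule half_less_ln_double) simp
  have \<delta>: "0 < \<epsilon> / sqrt 2" "(\<epsilon> / sqrt 2)\<^sup>2 = \<epsilon>\<^sup>2 / 2"
    using \<open>0 < \<epsilon>\<close> by (auto simp: power_divide)
  show thesis
  proof (cases "(real n)\<^sup>2 * (\<epsilon> / sqrt 2)\<^sup>2 * (\<epsilon> / sqrt 2)\<^sup>2 < 1")
    case True
    have "\<epsilon> / sqrt 2 \<le> \<epsilon>"
      using \<open>0 < \<epsilon>\<close> by (simp add: divide_le_eq)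
    then have "norm \<theta> \<le> \<epsilon>" if "\<theta> \<in> \<Gamma>" for \<theta>
      using gof_ok_imp_norm_less[OF gof \<Gamma> \<delta>(1) that True] by linarith
    then show thesis
      using that[OF est_ok_0, folded L_def] L by simp
  next
    case False
    then have "4 \<le> (real n)\<^sup>2 * \<epsilon>\<^sup>2 * \<epsilon>\<^sup>2"
      by (simp add: \<delta>(2))
    then obtain m where "0 < m" and m: "real m \<le> 64 * L * ((real n)\<^sup>2 * \<epsilon>\<^sup>2)"
      and level: "(real n)\<^sup>2 * (64 * L / real m) * (\<epsilon>\<^sup>2 / 2) < 1" and tail: "1 / real m \<le> \<epsilon>\<^sup>2 / 2"
      using obtain_sample_size[OF less_imp_le[OF L]] by blast
    have "(\<Sum>i\<in>UNIV. min ((\<theta> $ i)\<^sup>2) (64 * L / real m)) + 1 / real m \<le> \<epsilon>\<^sup>2" if "\<theta> \<in> \<Gamma>" for \<theta>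
    proof -
      have "(\<Sum>i\<in>UNIV. min ((\<theta> $ i)\<^sup>2) (64 * L / real m)) < \<epsilon>\<^sup>2 / 2"
        using gof_ok_imp_sum_min_less[OF gof \<Gamma> \<delta>(1) that, of "64 * L / real m"] level L by (simp add: \<delta>(2))
      with tail show ?thesis
        by linarith
    qed
    then have "est_ok \<Gamma> \<epsilon> m"
      unfolding L_def by (rule est_ok_if_sum_min_log_le[OF \<open>0 < m\<close>])
    with m show thesis
      using that unfolding L_def by blast
  qed
qed

theorem mainTheorem3:
  fixes \<Gamma> :: "(real ^ 'd) set" and \<epsilon> :: real
  assumes "orthosymmetric \<Gamma>" and "compact \<Gamma>" and "convex \<Gamma>" and "\<epsilon> > 0"
  shows "(real (n_gof \<Gamma> (\<epsilon> / sqrt 2)))\<^sup>2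
           \<ge> 1 / (64 * ln (2 * real CARD('d))) * (real (n_est \<Gamma> \<epsilon>) / \<epsilon>\<^sup>2)"
proof -
  define L where "L = ln (2 * real CARD('d))"
  have "1/2 < L"
    unfolding L_def by (rule half_less_ln_double) simp
  let ?n = "n_gof \<Gamma> (\<epsilon> / sqrt 2)"
  have "gof_ok \<Gamma> (\<epsilon> / sqrt 2) ?n"
    unfolding n_gof_def by (rule LeastI_ex[OF gof_ok_exists]) (simp add: \<open>\<epsilon> > 0\<close>)
  then obtain m where est: "est_ok \<Gamma> \<epsilon> m" and m: "real m \<le> 64 * L * ((real ?n)\<^sup>2 * \<epsilon>\<^sup>2)"
    unfolding L_def using gof_ok_imp_est_ok[OF _ \<open>orthosymmetric \<Gamma>\<close> \<open>convex \<Gamma>\<close> \<open>\<epsilon> > 0\<close>] by blast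
  have "n_est \<Gamma> \<epsilon> \<le> m"
    unfolding n_est_def using est by (rule Least_le)
  with m have "real (n_est \<Gamma> \<epsilon>) \<le> 64 * L * ((real ?n)\<^sup>2 * \<epsilon>\<^sup>2)"
    by linarith
  then show ?thesis
    using \<open>1/2 < L\<close> \<open>\<epsilon> > 0\<close> unfolding L_def[symmetric] by (simp add: field_simps)
qed

end
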